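(* Let $s$ and $d$ be coprime positive integers. The number of $(s,s+d,s+2d,s+3d)$-core partitions is $$\frac{1}{s+d}\sum_{k=0}^{\lfloor s/2\rfloor}\left\{\binom{s+d-k-1}{k-1}+\binom{s+d-k}{k}\right\}\binom{s+d-k}{s-2k}.$$
   Context: A partition is a finite non-increasing sequence of positive integers (the empty partition is allowed). The hook length of a cell of the Ferrers diagram of a partition is the number of cells in its arm plus the number in its leg plus one. A partition is an $a$-core if no cell of its Ferrers diagram has hook length divisible by $a$; it is an $(a_1,\dots,a_n)$-core if it is simultaneously an $a_i$-core for every $i$. Convention: $\binom{p}{q}=0$ if either $p$ or $q$ is negative. *)

theory Defs
  imports Complex_Main
begin

definition is_partition :: "nat list \<Rightarrow> bool" where
  "is_partition p \<longleftrightarrow> sorted_wrt (\<ge>) p \<and> (\<forall>x\<in>set p. 0 < x)"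

text \<open>Cells are pairs (row, column), both counted from 0.\<close>

definition ferrers :: "nat list \<Rightarrow> (nat \<times> nat) set" where
  "ferrers p = {(i, j). i < length p \<and> j < p ! i}"

definition arm :: "nat list \<Rightarrow> nat \<times> nat \<Rightarrow> (nat \<times> nat) set" where
  "arm p c = {(i, j) \<in> ferrers p. i = fst c \<and> snd c < j}"

definition leg :: "nat list \<Rightarrow> nat \<times> nat \<Rightarrow> (nat \<times> nat) set" where
  "leg p c = {(i, j) \<in> ferrers p. j = snd c \<and> fst c < i}"

definition hook_length :: "nat list \<Rightarrow> nat \<times> nat \<Rightarrow> nat" where
  "hook_length p c = card (arm p c) + card (leg p c) + 1"

definition is_core :: "nat \<Rightarrow> nat list \<Rightarrow> bool" where
  "is_core a p \<longleftrightarrow> is_partition p \<and> (\<forall>c\<in>ferrers p. \<not> a dvd hook_length p c)"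

definition is_simultaneous_core :: "nat list \<Rightarrow> nat list \<Rightarrow> bool" where
  "is_simultaneous_core as p \<longleftrightarrow> is_partition p \<and> (\<forall>a\<in>set as. is_core a p)"

text \<open>Integer arguments, so that a lower index of \<open>-1\<close> gives 0; truncated
  subtraction on the natural numbers would turn it into 0 and the coefficient into 1.\<close>

definition binom :: "int \<Rightarrow> int \<Rightarrow> nat" where
  "binom m k = (if m < 0 \<or> k < 0 then 0 else nat m choose nat k)"

end

theory Submission
  imports Defs
begin

text \<open>A partition is an \<open>a\<close>-core iff its beta set (the hook lengths of its first column) is closed
  under subtracting \<open>a\<close> as long as the result is not negative. Put \<open>m = s + d\<close>, so that the four
  moduli are \<open>m - d\<close>, \<open>m\<close>, \<open>m + d\<close>, \<open>m + 2 d\<close>. As \<open>d\<close> is coprime to \<open>m\<close>, every residue class modulo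
  \<open>m\<close> contains some \<open>j d\<close>; writing the least gap of the beta set in that class as \<open>j d + m h(j)\<close>
  turns the closure conditions into \<open>\<bar>h(j+1) - h(j)\<bar> \<le> 1\<close> and \<open>h(j+2) \<le> h(j) + 1\<close>, together with
  \<open>h(j+m) = h(j) - d\<close>. Cores thus become periodic paths with up, flat and down steps, without two
  consecutive up steps, that stay above the line \<open>j d + m h(j) = 0\<close>. By the cycle lemma these are
  one \<open>m\<close>-th of all such cyclic words, and the latter are counted by choosing \<open>k\<close> cyclically
  non-adjacent up steps and then \<open>s - 2 k\<close> flat steps among the other \<open>m - k\<close> positions.\<close>

section \<open>Beta sets\<close>

definition beta_set :: "nat list \<Rightarrow> nat set" where
  "beta_set p = (\<lambda>i. p ! i + (length p - Suc i)) ` {..<length p}"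

lemma beta_set_Nil [simp]: "beta_set [] = {}"
  by (simp add: beta_set_def)

lemma beta_set_Cons [simp]: "beta_set (x # xs) = insert (x + length xs) (beta_set xs)"
  by (simp add: beta_set_def lessThan_Suc_eq_insert_0 image_image)

lemma finite_beta_set [simp]: "finite (beta_set p)"
  by (simp add: beta_set_def)

lemma is_partition_Nil [simp]: "is_partition []"
  by (simp add: is_partition_def)

lemma is_partition_Cons:
  "is_partition (x # xs) \<longleftrightarrow> 0 < x \<and> (\<forall>y\<in>set xs. y \<le> x) \<and> is_partition xs"
  by (auto simp: is_partition_def)

lemma beta_set_less:
  assumes "\<forall>y\<in>set xs. y \<le> x" "b \<in> beta_set xs"
  shows "b < x + length xs"
proof -
  obtain i where i: "i < length xs" "b = xs ! i + (length xs - Suc i)"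
    using assms(2) by (auto simp: beta_set_def)
  have "xs ! i \<le> x" using assms(1) i(1) by simp
  with i show ?thesis by linarith
qed

lemma card_beta_set: "is_partition p \<Longrightarrow> card (beta_set p) = length p"
proof (induction p)
  case (Cons x xs)
  then have "x + length xs \<notin> beta_set xs"
    using beta_set_less[of xs x "x + length xs"] by (auto simp: is_partition_Cons)
  with Cons show ?case by (simp add: is_partition_Cons)
qed simp

lemma Max_beta_set:
  assumes "is_partition (x # xs)"
  shows "Max (beta_set (x # xs)) = x + length xs"
  using assms beta_set_less[of xs x]
  by (intro Max_eqI) (auto simp: is_partition_Cons intro: less_imp_le)

text \<open>The cardinality of the beta set recovers the number of parts and its maximum then
  recovers the first part. Removing the maximum leaves the beta set of the tail.\<close>

lemma beta_set_inject:
  "is_partition p \<Longrightarrow> is_partition q \<Longrightarrow> beta_set p = beta_set q \<Longrightarrow> p = q"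
proof (induction p arbitrary: q)
  case Nil
  then show ?case using card_beta_set[of q] by simp
next
  case (Cons x xs)
  have len: "length q = Suc (length xs)"
    using card_beta_set[OF Cons.prems(1)] card_beta_set[OF Cons.prems(2)] Cons.prems(3) by simp
  then obtain y ys where q: "q = y # ys" by (cases q) auto
  have x: "y = x"
    using Max_beta_set[OF Cons.prems(1)] Max_beta_set[of y ys] Cons.prems len q by simp
  have "x + length xs \<notin> beta_set xs" "x + length xs \<notin> beta_set ys"
    using beta_set_less[of xs x "x + length xs"] beta_set_less[of ys y "x + length xs"]
      Cons.prems len q x by (auto simp: is_partition_Cons)
  moreover have "insert (x + length xs) (beta_set xs) = insert (x + length xs) (beta_set ys)"
    using Cons.prems(3) q x len by simp
  ultimately have "beta_set xs = beta_set ys" by (metis insert_ident)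
  then have "xs = ys" using Cons.IH Cons.prems q by (simp add: is_partition_Cons)
  then show ?case using q x by simp
qed

text \<open>Elements are added in increasing order, each new maximum \<open>b\<close> becoming the
  beta number of a new first row. The exclusion of 0 keeps the parts positive.\<close>

lemma beta_set_surj:
  assumes "finite X" "0 \<notin> X"
  shows "\<exists>p. is_partition p \<and> beta_set p = X"
  using assms
proof (induction rule: finite_linorder_max_induct)
  case empty
  show ?case by (intro exI[of _ "[]"]) simp
next
  case (insert b A)
  then obtain ps where ps: "is_partition ps" "beta_set ps = A" by auto
  show ?case
  proof (cases ps)
    case Nil
    then show ?thesis using ps insert
      by (intro exI[of _ "[b]"]) (auto simp: is_partition_Cons)
  next
    case (Cons y ys)
    \<comment> \<open>The beta number of the old first row lies in \<open>A\<close>, so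
      \<open>b\<close> exceeds it. This is exactly what makes the new part
      \<open>b - length ps\<close> at least \<open>y\<close>.\<close>
    have "y + length ys < b" using insert ps Cons by auto
    then have "length ps \<le> b" "y \<le> b - length ps" using Cons by auto
    then have "is_partition ((b - length ps) # ps)" "beta_set ((b - length ps) # ps) = insert b A"
      using ps Cons by (auto simp: is_partition_Cons intro: order_trans)
    then show ?thesis by blast
  qed
qed

lemma zero_notin_beta_set: "is_partition p \<Longrightarrow> 0 \<notin> beta_set p"
  unfolding beta_set_def is_partition_def
  by (metis (no_types, lifting) add_is_0 imageE less_irrefl lessThan_iff nth_mem)

section \<open>Hook lengths as differences of beta numbers and gaps\<close>

text \<open>The values of \<open>gap_of p\<close> are the elements of the complement of the beta set, so that
  hook lengths become differences of elements and non-elements.\<close>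

definition gap_of :: "nat list \<Rightarrow> nat \<Rightarrow> nat" where
  "gap_of p j = j + card {i. i < length p \<and> p ! i \<le> j}"

lemma strict_mono_gap_of: "strict_mono (gap_of p)"
  unfolding strict_mono_def gap_of_def
  by (auto intro!: add_less_le_mono card_mono)

lemma partition_nth_mono:
  "is_partition p \<Longrightarrow> i \<le> k \<Longrightarrow> k < length p \<Longrightarrow> p ! k \<le> p ! i"
  unfolding is_partition_def using sorted_wrt_nth_less[of "(\<ge>)" p i k]
  by (cases "i = k") auto

text \<open>Column \<open>j\<close> separates the gap strictly from every beta number. If row
  \<open>i\<close> does not reach beyond column \<open>j\<close>, neither do the rows after it, and
  counting them puts the gap above the beta number of row \<open>i\<close>. Otherwise only rows
  after \<open>i\<close> are counted, which puts it below.\<close>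

lemma gap_of_notin_beta_set:
  assumes "is_partition p"
  shows "gap_of p j \<notin> beta_set p"
proof
  assume "gap_of p j \<in> beta_set p"
  then obtain i where i: "i < length p" "gap_of p j = p ! i + (length p - Suc i)"
    by (auto simp: beta_set_def)
  show False
  proof (cases "p ! i \<le> j")
    case True
    have "{i..<length p} \<subseteq> {i. i < length p \<and> p ! i \<le> j}"
    proof
      fix k assume "k \<in> {i..<length p}"
      then show "k \<in> {i. i < length p \<and> p ! i \<le> j}"
        using partition_nth_mono[OF assms, of i k] True by simp
    qed
    from card_mono[OF _ this] have "length p - i \<le> card {i. i < length p \<and> p ! i \<le> j}" by simp
    with i True show False by (simp add: gap_of_def)
  next
    case False
    have "{i. i < length p \<and> p ! i \<le> j} \<subseteq> {Suc i..<length p}"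
    proof
      fix k assume "k \<in> {i. i < length p \<and> p ! i \<le> j}"
      then show "k \<in> {Suc i..<length p}"
        using partition_nth_mono[OF assms, of k i] i False by (cases "k \<le> i") auto
    qed
    from card_mono[OF _ this] have "card {i. i < length p \<and> p ! i \<le> j} \<le> length p - Suc i" by simp
    with i False show False by (simp add: gap_of_def)
  qed
qed

text \<open>The rows after \<open>i\<close> split into those that meet column \<open>j\<close>,
  which form the leg, and the others, which are exactly the rows counted by
  \<open>gap_of p j\<close>.\<close>

lemma hook_length_plus_gap_of:
  assumes "is_partition p" "i < length p" "j < p ! i"
  shows "hook_length p (i, j) + gap_of p j = p ! i + (length p - Suc i)"
proof -
  let ?L = "{k. i < k \<and> k < length p \<and> j < p ! k}"
  let ?G = "{k. k < length p \<and> p ! k \<le> j}"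
  have "arm p (i, j) = Pair i ` {j<..<p ! i}"
    using assms by (auto simp: arm_def ferrers_def)
  then have arm: "card (arm p (i, j)) = p ! i - Suc j"
    by (simp add: card_image inj_on_def)
  have "leg p (i, j) = (\<lambda>k. (k, j)) ` ?L"
    by (auto simp: leg_def ferrers_def)
  then have leg: "card (leg p (i, j)) = card ?L"
    by (simp add: card_image inj_on_def)
  have "i < k" if "k \<in> ?G" for k
    using partition_nth_mono[OF assms(1), of k i] that assms(2,3) by (force simp: not_le[symmetric])
  then have "?L \<union> ?G = {Suc i..<length p}" by (auto simp: Suc_le_eq)
  moreover have "card (?L \<union> ?G) = card ?L + card ?G"
    by (rule card_Un_disjoint) auto
  ultimately have "card ?L + card ?G = length p - Suc i" by simp
  with arm leg assms(3) show ?thesis by (simp add: hook_length_def gap_of_def)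
qed

text \<open>One inclusion and a count suffice: the beta numbers below that of row \<open>i\<close>
  are those of the later rows, so exactly \<open>p ! i\<close> gaps remain.\<close>

lemma gaps_below:
  assumes "is_partition p" "i < length p"
  shows "gap_of p ` {..<p ! i} = {..<p ! i + (length p - Suc i)} - beta_set p"
proof (rule card_subset_eq)
  let ?b = "\<lambda>i. p ! i + (length p - Suc i)"
  show "gap_of p ` {..<p ! i} \<subseteq> {..<?b i} - beta_set p"
  proof safe
    fix j assume "j < p ! i"
    then show "gap_of p j < ?b i"
      using hook_length_plus_gap_of[OF assms, of j] by (simp add: hook_length_def)
  qed (use gap_of_notin_beta_set[OF assms(1)] in blast)
  have mono: "?b k < ?b l" if "l < k" "k < length p" for k l
    using partition_nth_mono[OF assms(1), of l k] that by simp
  have "{..<?b i} \<inter> beta_set p = ?b ` {Suc i..<length p}"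
  proof (intro equalityI subsetI)
    fix x assume "x \<in> {..<?b i} \<inter> beta_set p"
    then obtain k where k: "k < length p" "x = ?b k" "?b k < ?b i" by (auto simp: beta_set_def)
    then have "i < k" using mono[of k i] assms(2) by (metis less_asym less_irrefl linorder_neqE_nat)
    with k show "x \<in> ?b ` {Suc i..<length p}" by auto
  next
    fix x assume "x \<in> ?b ` {Suc i..<length p}"
    then show "x \<in> {..<?b i} \<inter> beta_set p" using mono[of i] by (auto simp: beta_set_def)
  qed
  moreover have "inj_on ?b {Suc i..<length p}"
  proof (rule linorder_inj_onI)
    fix x y assume "x < y" "y \<in> {Suc i..<length p}"
    then show "?b x \<noteq> ?b y" using mono[of x y] by simp
  qed auto
  ultimately have "card ({..<?b i} \<inter> beta_set p) = length p - Suc i"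
    by (simp only: card_image card_atLeastLessThan)
  then have "card ({..<?b i} - beta_set p) = p ! i"
    by (simp add: card_Diff_subset_Int)
  moreover have "inj_on (gap_of p) {..<p ! i}"
    using strict_mono_gap_of by (metis inj_on_subset strict_mono_imp_inj_on subset_UNIV)
  ultimately show "card (gap_of p ` {..<p ! i}) = card ({..<?b i} - beta_set p)"
    by (simp add: card_image)
qed simp

section \<open>Cores as sets closed under subtraction\<close>

definition sub_closed :: "nat \<Rightarrow> nat set \<Rightarrow> bool" where
  "sub_closed a X \<longleftrightarrow> (\<forall>b\<in>X. a \<le> b \<longrightarrow> b - a \<in> X)"

lemma sub_closed_mult: "sub_closed a X \<Longrightarrow> b \<in> X \<Longrightarrow> n * a \<le> b \<Longrightarrow> b - n * a \<in> X"
proof (induction n)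
  case (Suc n)
  then have "b - n * a \<in> X" "a \<le> b - n * a" by auto
  then have "b - n * a - a \<in> X" using Suc.prems(1) by (auto simp: sub_closed_def)
  then show ?case by (simp add: algebra_simps)
qed simp

text \<open>By \<open>gaps_below\<close>, the hook lengths in a row are the differences between its
  beta number and the smaller gaps. A difference divisible by \<open>a\<close> is a descent in steps
  of \<open>a\<close> that leaves the set, and some single step of it must already leave.\<close>

lemma is_core_iff_sub_closed:
  assumes p: "is_partition p" and a: "0 < a"
  shows "is_core a p \<longleftrightarrow> sub_closed a (beta_set p)"
proof -
  let ?b = "\<lambda>i. p ! i + (length p - Suc i)"
  have "is_core a p \<longleftrightarrow> (\<forall>i<length p. \<forall>j<p ! i. \<not> a dvd hook_length p (i, j))"
    using p by (auto simp: is_core_def ferrers_def)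
  also have "\<dots> \<longleftrightarrow> (\<forall>i<length p. \<forall>j<p ! i. \<not> a dvd ?b i - gap_of p j)"
  proof -
    have "hook_length p (i, j) = ?b i - gap_of p j" if "i < length p" "j < p ! i" for i j
      using hook_length_plus_gap_of[OF p that] by simp
    then show ?thesis by simp
  qed
  also have "\<dots> \<longleftrightarrow> (\<forall>i<length p. \<forall>y\<in>{..<?b i} - beta_set p. \<not> a dvd ?b i - y)"
  proof -
    have "(\<forall>j<p ! i. \<not> a dvd ?b i - gap_of p j) \<longleftrightarrow> (\<forall>y\<in>gap_of p ` {..<p ! i}. \<not> a dvd ?b i - y)" for i
      by auto
    then show ?thesis by (simp only: gaps_below[OF p] cong: imp_cong)
  qed
  also have "\<dots> \<longleftrightarrow> (\<forall>b\<in>beta_set p. \<forall>y<b. y \<notin> beta_set p \<longrightarrow> \<not> a dvd b - y)"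
    by (auto simp: beta_set_def)
  also have "\<dots> \<longleftrightarrow> sub_closed a (beta_set p)"
  proof
    assume *: "\<forall>b\<in>beta_set p. \<forall>y<b. y \<notin> beta_set p \<longrightarrow> \<not> a dvd b - y"
    show "sub_closed a (beta_set p)"
      unfolding sub_closed_def
    proof (intro ballI impI, rule ccontr)
      fix b assume "b \<in> beta_set p" "a \<le> b" "b - a \<notin> beta_set p"
      moreover have "b - a < b" using a \<open>a \<le> b\<close> by simp
      ultimately have "\<not> a dvd b - (b - a)" using * by blast
      with \<open>a \<le> b\<close> show False by simp
    qed
  next
    assume *: "sub_closed a (beta_set p)"
    show "\<forall>b\<in>beta_set p. \<forall>y<b. y \<notin> beta_set p \<longrightarrow> \<not> a dvd b - y"
    proof (intro ballI allI impI notI)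
      fix b y assume b: "b \<in> beta_set p" "y < b" "y \<notin> beta_set p" "a dvd b - y"
      then obtain n where "b - y = n * a" by (metis dvdE mult.commute)
      with b(2) have "n * a \<le> b" "y = b - n * a" by auto
      with sub_closed_mult[OF * b(1)] b(3) show False by simp
    qed
  qed
  finally show ?thesis .
qed

lemma bij_betw_cores_sub_closed:
  assumes "0 \<notin> set as"
  shows "bij_betw beta_set {p. is_simultaneous_core as p}
    {X. finite X \<and> 0 \<notin> X \<and> (\<forall>a\<in>set as. sub_closed a X)}"
proof (rule bij_betwI')
  fix p q assume "p \<in> {p. is_simultaneous_core as p}" "q \<in> {p. is_simultaneous_core as p}"
  then show "beta_set p = beta_set q \<longleftrightarrow> p = q"
    using beta_set_inject by (auto simp: is_simultaneous_core_def)
next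
  fix p assume p: "p \<in> {p. is_simultaneous_core as p}"
  then have "sub_closed a (beta_set p)" if "a \<in> set as" for a
    using is_core_iff_sub_closed[of p a] that assms by (cases "a = 0") (auto simp: is_simultaneous_core_def)
  with p show "beta_set p \<in> {X. finite X \<and> 0 \<notin> X \<and> (\<forall>a\<in>set as. sub_closed a X)}"
    using zero_notin_beta_set by (auto simp: is_simultaneous_core_def)
next
  fix X assume X: "X \<in> {X. finite X \<and> 0 \<notin> X \<and> (\<forall>a\<in>set as. sub_closed a X)}"
  then obtain p where p: "is_partition p" "beta_set p = X" using beta_set_surj by blast
  have "is_core a p" if "a \<in> set as" for a
    using is_core_iff_sub_closed[OF p(1), of a] that assms X p(2) by (cases "a = 0") auto
  with p show "\<exists>p\<in>{p. is_simultaneous_core as p}. X = beta_set p"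
    by (auto simp: is_simultaneous_core_def)
qed

section \<open>Periodic paths\<close>

text \<open>The moduli \<open>m + d\<close> and \<open>m - d\<close> bound a step from above and
  from below, and \<open>m + 2 * d\<close> excludes two consecutive up steps. Modulus
  \<open>m\<close> is encoded by having a single threshold per residue class. Paths are infinite
  functions so that rotation needs no wrap-around.\<close>

definition paths :: "nat \<Rightarrow> nat \<Rightarrow> (nat \<Rightarrow> int) set" where
  "paths m d = {h. h 0 = 0 \<and> (\<forall>j. h (j + m) = h j - int d) \<and>
    (\<forall>j. \<bar>h (Suc j) - h j\<bar> \<le> 1) \<and> (\<forall>j. h (Suc (Suc j)) \<le> h j + 1)}"

text \<open>This is \<open>m\<close> times the height of the path above the line of slope
  \<open>- d / m\<close>, which is the mean slope of the path; hence it is periodic.\<close>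

definition elevation :: "nat \<Rightarrow> nat \<Rightarrow> (nat \<Rightarrow> int) \<Rightarrow> nat \<Rightarrow> int" where
  "elevation m d h j = int j * int d + int m * h j"

definition dominant_paths :: "nat \<Rightarrow> nat \<Rightarrow> (nat \<Rightarrow> int) set" where
  "dominant_paths m d = {h \<in> paths m d. \<forall>j. 0 \<le> elevation m d h j}"

lemma paths_0: "h \<in> paths m d \<Longrightarrow> h 0 = 0"
  and paths_period: "h \<in> paths m d \<Longrightarrow> h (j + m) = h j - int d"
  and paths_step: "h \<in> paths m d \<Longrightarrow> \<bar>h (Suc j) - h j\<bar> \<le> 1"
  and paths_two_steps: "h \<in> paths m d \<Longrightarrow> h (Suc (Suc j)) \<le> h j + 1"
  by (auto simp: paths_def)

lemma elevation_period: "h \<in> paths m d \<Longrightarrow> elevation m d h (j + m) = elevation m d h j"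
  by (simp add: elevation_def paths_period algebra_simps)

lemma elevation_mod: "h \<in> paths m d \<Longrightarrow> elevation m d h (j mod m) = elevation m d h j"
proof -
  assume h: "h \<in> paths m d"
  have "elevation m d h (j + q * m) = elevation m d h j" for j q
  proof (induction q)
    case (Suc q)
    then show ?case using elevation_period[OF h, of "j + q * m"] by (simp add: algebra_simps)
  qed simp
  from this[of "j mod m" "j div m"] show ?thesis by simp
qed

section \<open>Residue classes modulo \<open>m\<close> as multiples of \<open>d\<close>\<close>

lemma multiples_cong_cancel:
  fixes j k m d :: nat
  assumes "coprime d m" "int m dvd int j * int d - int k * int d"
  shows "j mod m = k mod m"
proof -
  have "int m dvd (int j - int k) * int d" using assms(2) by (simp add: algebra_simps)
  moreover have "coprime (int m) (int d)" using assms(1) by (simp add: coprime_commute)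
  ultimately have "int m dvd int j - int k" by (simp add: coprime_dvd_mult_left_iff)
  then have "int j mod int m = int k mod int m" by (simp add: mod_eq_dvd_iff)
  then show ?thesis by (simp flip: of_nat_mod)
qed

lemma multiples_cong_ex:
  fixes m d :: nat and x :: int
  assumes "coprime d m" "0 < m"
  obtains j where "int m dvd x - int j * int d"
proof -
  have "coprime (int d) (int m)" using assms(1) by simp
  then obtain u v where uv: "u * int d + v * int m = 1"
    by (metis bezout_int coprime_imp_gcd_eq_1)
  \<comment> \<open>Multiplying the Bezout identity by \<open>x\<close> gives the coefficient
    \<open>x * u\<close>; its reduction modulo \<open>m\<close> makes it a natural number.\<close>
  let ?j = "nat ((x * u) mod int m)"
  have j: "int ?j = (x * u) mod int m" using assms(2) by simp
  have "x - (x * u) * int d = int m * (x * v)"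
    using arg_cong[OF uv, of "\<lambda>t. x * t"] by (simp add: algebra_simps)
  moreover have "int m dvd (x * u - (x * u) mod int m) * int d"
    by (simp add: minus_mod_eq_mult_div)
  ultimately have "int m dvd (x - (x * u) * int d) + (x * u - (x * u) mod int m) * int d"
    by simp
  also have "\<dots> = x - int ?j * int d" unfolding j by (simp add: algebra_simps)
  finally show thesis by (rule that)
qed

lemma elevation_cong:
  assumes "coprime d m" "h \<in> paths m d" "int m dvd int j * int d - int k * int d"
  shows "elevation m d h j = elevation m d h k"
  using multiples_cong_cancel[OF assms(1,3)] elevation_mod[OF assms(2)] by metis

lemma elevation_residue: "int m dvd elevation m d h j - int j * int d"
  by (simp add: elevation_def)

lemma elevation_inject:
  assumes "0 < m" "\<And>j. elevation m d g j = elevation m d h j"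
  shows "g = h"
  using assms by (auto simp: elevation_def)

section \<open>Rotations and the cycle lemma\<close>

definition rotate_path :: "nat \<Rightarrow> (nat \<Rightarrow> int) \<Rightarrow> nat \<Rightarrow> int" where
  "rotate_path u h j = h (j + u) - h u"

lemma rotate_path_in_paths: "h \<in> paths m d \<Longrightarrow> rotate_path u h \<in> paths m d"
  using paths_period[of h m d "_ + u"] paths_step[of h m d "_ + u"] paths_two_steps[of h m d "_ + u"]
  by (auto simp: paths_def rotate_path_def ac_simps)

lemma elevation_rotate_path:
  "elevation m d (rotate_path u h) j = elevation m d h (j + u) - elevation m d h u"
  by (simp add: elevation_def rotate_path_def algebra_simps)

lemma rotate_path_rotate_path: "rotate_path u (rotate_path v h) = rotate_path (u + v) h"
  by (auto simp: rotate_path_def ac_simps)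

lemma rotate_path_period: "h \<in> paths m d \<Longrightarrow> rotate_path m h = h"
  using paths_period[of h m d 0] by (auto simp: rotate_path_def paths_period paths_0)

text \<open>The cycle lemma: the minimal elevation of a path is attained at exactly one
  position modulo \<open>m\<close>, since positions of equal elevation are congruent; rotating the path
  to start there makes it dominant.\<close>

lemma bij_betw_rotate_path:
  assumes "coprime d m" "0 < m"
  shows "bij_betw (\<lambda>(h, u). rotate_path u h) (dominant_paths m d \<times> {..<m}) (paths m d)"
proof (rule bij_betwI')
  fix p q assume "p \<in> dominant_paths m d \<times> {..<m}" "q \<in> dominant_paths m d \<times> {..<m}"
  then obtain g u h v where p: "p = (g, u)" "g \<in> paths m d" "\<And>j. 0 \<le> elevation m d g j" "u < m"
    and q: "q = (h, v)" "h \<in> paths m d" "\<And>j. 0 \<le> elevation m d h j" "v < m"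
    by (auto simp: dominant_paths_def)
  have zero: "elevation m d f m = 0" if "f \<in> paths m d" for f
    using elevation_period[OF that, of 0] by (simp add: elevation_def paths_0[OF that])
  show "(case p of (h, u) \<Rightarrow> rotate_path u h) = (case q of (h, u) \<Rightarrow> rotate_path u h) \<longleftrightarrow> p = q"
  proof
    assume "(case p of (h, u) \<Rightarrow> rotate_path u h) = (case q of (h, u) \<Rightarrow> rotate_path u h)"
    then have eq: "rotate_path u g = rotate_path v h" using p q by simp
    then have el: "elevation m d g (j + u) - elevation m d g u = elevation m d h (j + v) - elevation m d h v" for j
      by (metis elevation_rotate_path)
    \<comment> \<open>At \<open>j = m - v\<close> the path \<open>h\<close> has completed a period
      and has elevation 0, while \<open>g\<close> has nonnegative elevation by dominance.\<close>
    have "elevation m d h v \<le> elevation m d g u"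
      using el[of "m - v"] p(3)[of "m - v + u"] zero[OF q(2)] q(4) by simp
    moreover have "elevation m d g u \<le> elevation m d h v"
      using el[of "m - u"] q(3)[of "m - u + v"] zero[OF p(2)] p(4) by simp
    ultimately have "elevation m d g u = elevation m d h v" by simp
    then have "int m dvd int v * int d - int u * int d"
      using dvd_diff[OF elevation_residue[of m d g u] elevation_residue[of m d h v]] by simp
    then have "u = v" using multiples_cong_cancel[OF assms(1)] p(4) q(4) by fastforce
    moreover have "g = h"
      using arg_cong[OF eq, of "rotate_path (m - u)"] \<open>u = v\<close> p(2,4) q(2)
      by (simp add: rotate_path_rotate_path rotate_path_period)
    ultimately show "p = q" using p q by simp
  qed simp
next
  fix p assume "p \<in> dominant_paths m d \<times> {..<m}"
  then show "(case p of (h, u) \<Rightarrow> rotate_path u h) \<in> paths m d"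
    by (auto simp: dominant_paths_def intro: rotate_path_in_paths)
next
  fix g assume g: "g \<in> paths m d"
  obtain i where i: "i < m" "\<And>j. j < m \<Longrightarrow> elevation m d g i \<le> elevation m d g j"
    using ex_is_arg_min_if_finite[of "{..<m}" "elevation m d g"] assms(2)
    by (auto simp: is_arg_min_linorder)
  have le: "elevation m d g i \<le> elevation m d g j" for j
    using i(2)[of "j mod m"] elevation_mod[OF g, of j] assms(2) by simp
  \<comment> \<open>Rotating by \<open>m - i\<close> completes the rotation by \<open>i\<close> to a
    full period. The \<open>mod\<close> brings the shift back into range when
    \<open>i = 0\<close>.\<close>
  define h u where "h = rotate_path i g" and "u = (m - i) mod m"
  have "h \<in> dominant_paths m d"
    using g le by (auto simp: h_def dominant_paths_def elevation_rotate_path intro: rotate_path_in_paths)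
  moreover have "u < m" using assms(2) by (simp add: u_def)
  moreover have "rotate_path u h = g"
  proof (cases "i = 0")
    case True
    then show ?thesis using paths_0[OF g] by (auto simp: h_def u_def rotate_path_def)
  next
    case False
    then have "u + i = m" using i(1) by (simp add: u_def)
    then show ?thesis by (simp add: h_def rotate_path_rotate_path rotate_path_period[OF g])
  qed
  ultimately show "\<exists>p\<in>dominant_paths m d \<times> {..<m}. g = (case p of (h, u) \<Rightarrow> rotate_path u h)"
    by (intro bexI[of _ "(h, u)"]) auto
qed

section \<open>Bijection between dominant paths and closed sets\<close>

text \<open>\<open>elevation m d h j\<close> plays the role of the least gap in the residue class of \<open>j d\<close>.\<close>

definition path_set :: "nat \<Rightarrow> nat \<Rightarrow> (nat \<Rightarrow> int) \<Rightarrow> nat set" where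
  "path_set m d h = {x. \<exists>j. int m dvd int x - int j * int d \<and> int x < elevation m d h j}"

text \<open>All indices \<open>j\<close> representing the class of \<open>x\<close> have the same
  elevation, so the existential in \<open>path_set\<close> may be tested at any one of them.\<close>

lemma mem_path_set_iff:
  assumes "coprime d m" "h \<in> paths m d" "int m dvd int x - int j * int d"
  shows "x \<in> path_set m d h \<longleftrightarrow> int x < elevation m d h j"
proof
  assume "x \<in> path_set m d h"
  then obtain k where k: "int m dvd int x - int k * int d" "int x < elevation m d h k"
    by (auto simp: path_set_def)
  have "int m dvd int k * int d - int j * int d"
    using dvd_diff[OF assms(3) k(1)] by (simp add: algebra_simps)
  with k(2) elevation_cong[OF assms(1,2)] show "int x < elevation m d h j" by simp
qed (use assms(3) in \<open>auto simp: path_set_def\<close>)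

text \<open>Subtracting \<open>a\<close> leads from the class of \<open>j * d\<close> to that of
  \<open>k * d\<close>, so it is enough that the threshold drops by at most
  \<open>a\<close>.\<close>

lemma sub_closed_path_set:
  assumes "coprime d m" "0 < m" "h \<in> paths m d"
    and "\<And>j. \<exists>k. int m dvd int a + int k * int d - int j * int d \<and>
      elevation m d h j \<le> elevation m d h k + int a"
  shows "sub_closed a (path_set m d h)"
  unfolding sub_closed_def
proof (intro ballI impI)
  fix b assume b: "b \<in> path_set m d h" "a \<le> b"
  obtain j where j: "int m dvd int b - int j * int d" using multiples_cong_ex[OF assms(1,2)] .
  obtain k where k: "int m dvd int a + int k * int d - int j * int d"
    "elevation m d h j \<le> elevation m d h k + int a" using assms(4) by blast
  have "int m dvd int (b - a) - int k * int d"
    using dvd_diff[OF j k(1)] b(2) by (simp add: of_nat_diff algebra_simps)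
  moreover have "int (b - a) < elevation m d h k"
    using b mem_path_set_iff[OF assms(1,3) j] k(2) by (simp add: of_nat_diff)
  ultimately show "b - a \<in> path_set m d h" by (auto simp: path_set_def)
qed

lemma finite_path_set:
  assumes "0 < m" "h \<in> paths m d"
  shows "finite (path_set m d h)"
proof -
  have "path_set m d h \<subseteq> (\<Union>j<m. {..<nat (elevation m d h j)})"
  proof
    fix x assume "x \<in> path_set m d h"
    then obtain j where "int x < elevation m d h (j mod m)"
      using elevation_mod[OF assms(2)] by (auto simp: path_set_def)
    then show "x \<in> (\<Union>j<m. {..<nat (elevation m d h j)})"
      using assms(1) by (intro UN_I[of "j mod m"]) auto
  qed
  then show ?thesis by (rule finite_subset) simp
qed

text \<open>Dominance makes every elevation a natural number, hence an actual non-element of the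
  set. Comparing these non-elements in both directions gives equal elevations.\<close>

lemma path_set_inject:
  assumes "coprime d m" "0 < m" "g \<in> dominant_paths m d" "h \<in> dominant_paths m d"
    and "path_set m d g = path_set m d h"
  shows "g = h"
proof -
  have "elevation m d h j \<le> elevation m d g j"
    if "g \<in> dominant_paths m d" "h \<in> dominant_paths m d" "path_set m d g = path_set m d h" for g h j
  proof -
    let ?n = "nat (elevation m d g j)"
    have n: "int ?n = elevation m d g j" using that(1) by (simp add: dominant_paths_def)
    have dvd: "int m dvd int ?n - int j * int d" unfolding n by (rule elevation_residue)
    have "g \<in> paths m d" "h \<in> paths m d" using that by (auto simp: dominant_paths_def)
    note mem_path_set_iff[OF assms(1) this(1) dvd] mem_path_set_iff[OF assms(1) this(2) dvd]
    then show ?thesis using n that(3) by (metis less_irrefl not_le)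
  qed
  then show ?thesis using assms by (intro elevation_inject[of m d]) (auto intro: antisym)
qed

lemma path_set_surj:
  assumes "coprime d m" "d < m" "finite X" "0 \<notin> X"
    and closed: "sub_closed (m - d) X" "sub_closed m X" "sub_closed (m + d) X" "sub_closed (m + 2 * d) X"
  shows "\<exists>h\<in>dominant_paths m d. path_set m d h = X"
proof -
  have m: "0 < m" using assms(2) by simp
  define gap where "gap j = (LEAST y. y \<notin> X \<and> int m dvd int y - int j * int d)" for j
  define h where "h j = (int (gap j) - int j * int d) div int m" for j
  have ex: "\<exists>y. y \<notin> X \<and> int m dvd int y - int j * int d" for j
  proof -
    have "infinite (range (\<lambda>q. j * d + q * m))"
      using m by (simp add: finite_image_iff inj_on_def)
    then obtain q where "j * d + q * m \<notin> X" using assms(3) by (meson finite_subset image_subsetI)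
    then show ?thesis by (intro exI[of _ "j * d + q * m"]) simp
  qed
  have gap: "gap j \<notin> X" "int m dvd int (gap j) - int j * int d" for j
    using LeastI_ex[OF ex[of j]] by (auto simp: gap_def)
  have below_gap: "x \<in> X" if "int m dvd int x - int j * int d" "x < gap j" for x j
    using not_less_Least[of x] that unfolding gap_def by blast
  \<comment> \<open>Closure under \<open>m\<close> forces each class to meet \<open>X\<close> in an
    initial segment: an element above the gap would descend to it.\<close>
  have mem_iff: "x \<in> X \<longleftrightarrow> x < gap j" if x: "int m dvd int x - int j * int d" for x j
  proof
    assume "x \<in> X"
    show "x < gap j"
    proof (rule ccontr)
      assume "\<not> x < gap j"
      moreover have "int m dvd int x - int (gap j)" using dvd_diff[OF x gap(2)[of j]] by simp
      ultimately have "m dvd x - gap j" by (metis int_dvd_int_iff not_less of_nat_diff)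
      then obtain q where "x - gap j = q * m" by (metis dvdE mult.commute)
      with \<open>\<not> x < gap j\<close> have "q * m \<le> x" "x - q * m = gap j" by auto
      with sub_closed_mult[OF closed(2) \<open>x \<in> X\<close>] gap(1) show False by metis
    qed
  qed (use below_gap x in blast)
  \<comment> \<open>If \<open>gap k + a\<close> were below \<open>gap j\<close>, it would lie in
    \<open>X\<close>, and subtracting \<open>a\<close> would put \<open>gap k\<close> into
    \<open>X\<close>. Each path inequality below comes from one instance.\<close>
  have gap_le: "gap j \<le> gap k + a"
    if "sub_closed a X" "int m dvd int a + int k * int d - int j * int d" for a j k
  proof (rule ccontr)
    assume "\<not> gap j \<le> gap k + a"
    moreover have "int m dvd int (gap k + a) - int j * int d"
      using dvd_add[OF gap(2)[of k] that(2)] by (simp add: algebra_simps)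
    ultimately have "gap k + a \<in> X" using below_gap by simp
    with that(1) gap(1)[of k] show False by (auto simp: sub_closed_def)
  qed
  have elevation: "elevation m d h j = int (gap j)" for j
    using gap(2)[of j] by (simp add: elevation_def h_def)
  have "h \<in> paths m d"
  proof -
    have "gap 0 = 0" unfolding gap_def using assms(4) by (intro Least_equality) auto
    then have "h 0 = 0" by (simp add: h_def)
    moreover have "h (j + m) = h j - int d" for j
    proof -
      \<comment> \<open>Indices \<open>j\<close> and \<open>j + m\<close> name the same class; the
        drop of \<open>h\<close> by \<open>d\<close> comes only from the term \<open>j * d\<close>
        in its definition.\<close>
      have "gap (j + m) = gap j"
      proof -
        have "int m dvd int y - int (j + m) * int d \<longleftrightarrow> int m dvd int y - int j * int d" for y
          using dvd_add_left_iff[of "int m" "int m * int d" "int y - int (j + m) * int d"]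
          by (simp add: algebra_simps)
        then show ?thesis by (simp add: gap_def)
      qed
      then have "int m * h (j + m) = int m * (h j - int d)"
        using elevation[of j] elevation[of "j + m"] by (simp add: elevation_def algebra_simps)
      then show ?thesis using m by simp
    qed
    moreover have "h j \<le> h (Suc j) + 1" for j
    proof -
      have "gap j \<le> gap (Suc j) + (m - d)"
        using assms(2) by (intro gap_le[OF closed(1)]) (simp add: of_nat_diff algebra_simps)
      then have "elevation m d h j \<le> elevation m d h (Suc j) + int m - int d"
        using assms(2) unfolding elevation by linarith
      then have "int m * h j \<le> int m * (h (Suc j) + 1)" by (simp add: elevation_def algebra_simps)
      then show ?thesis using m by simp
    qed
    moreover have "h (Suc j) \<le> h j + 1" for j
    proof -
      have "gap (Suc j) \<le> gap j + (m + d)" by (intro gap_le[OF closed(3)]) (simp add: algebra_simps)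
      then have "elevation m d h (Suc j) \<le> elevation m d h j + int m + int d"
        unfolding elevation by linarith
      then have "int m * h (Suc j) \<le> int m * (h j + 1)" by (simp add: elevation_def algebra_simps)
      then show ?thesis using m by simp
    qed
    moreover have "h (Suc (Suc j)) \<le> h j + 1" for j
    proof -
      have "gap (Suc (Suc j)) \<le> gap j + (m + 2 * d)"
        by (intro gap_le[OF closed(4)]) (simp add: algebra_simps)
      then have "elevation m d h (Suc (Suc j)) \<le> elevation m d h j + int m + 2 * int d"
        unfolding elevation by linarith
      then have "int m * h (Suc (Suc j)) \<le> int m * (h j + 1)" by (simp add: elevation_def algebra_simps)
      then show ?thesis using m by simp
    qed
    ultimately show ?thesis by (auto simp: paths_def abs_le_iff algebra_simps)
  qed
  moreover from this have "path_set m d h = X"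
  proof (intro set_eqI)
    fix x
    obtain j where j: "int m dvd int x - int j * int d" using multiples_cong_ex[OF assms(1) m] .
    show "x \<in> path_set m d h \<longleftrightarrow> x \<in> X"
      using mem_path_set_iff[OF assms(1) \<open>h \<in> paths m d\<close> j] mem_iff[OF j] by (simp add: elevation)
  qed
  ultimately show ?thesis by (auto simp: dominant_paths_def elevation)
qed

lemma bij_betw_path_set:
  assumes "coprime d m" "d < m"
  shows "bij_betw (path_set m d) (dominant_paths m d)
    {X. finite X \<and> 0 \<notin> X \<and> (\<forall>a\<in>{m - d, m, m + d, m + 2 * d}. sub_closed a X)}"
proof (rule bij_betwI')
  have m: "0 < m" using assms(2) by simp
  fix g h assume "g \<in> dominant_paths m d" "h \<in> dominant_paths m d"
  then show "path_set m d g = path_set m d h \<longleftrightarrow> g = h"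
    using path_set_inject[OF assms(1) m] by blast
next
  have m: "0 < m" using assms(2) by simp
  fix h assume "h \<in> dominant_paths m d"
  then have h: "h \<in> paths m d" by (simp add: dominant_paths_def)
  have pos: "int m * x \<le> int m" if "x \<le> 1" for x
    using mult_left_mono[OF that, of "int m"] by simp
  have "0 \<notin> path_set m d h"
    using mem_path_set_iff[OF assms(1) h, of 0 0] by (simp add: elevation_def paths_0[OF h])
  moreover have "sub_closed (m - d) (path_set m d h)"
  proof (rule sub_closed_path_set[OF assms(1) m h])
    fix j show "\<exists>k. int m dvd int (m - d) + int k * int d - int j * int d \<and>
      elevation m d h j \<le> elevation m d h k + int (m - d)"
      \<comment> \<open>Subtracting \<open>m - d\<close> adds \<open>d\<close> modulo
        \<open>m\<close>, which leads to the class of index \<open>Suc j\<close>.\<close>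
      using pos[of "h j - h (Suc j)"] paths_step[OF h, of j] assms(2)
      by (intro exI[of _ "Suc j"]) (simp add: elevation_def of_nat_diff algebra_simps)
  qed
  moreover have "sub_closed m (path_set m d h)"
  proof (rule sub_closed_path_set[OF assms(1) m h])
    fix j show "\<exists>k. int m dvd int m + int k * int d - int j * int d \<and>
      elevation m d h j \<le> elevation m d h k + int m"
      by (intro exI[of _ j]) simp
  qed
  moreover have "sub_closed (m + d) (path_set m d h)"
  proof (rule sub_closed_path_set[OF assms(1) m h])
    fix j
    \<comment> \<open>Subtracting \<open>m + d\<close> leads to index \<open>j - 1\<close>; adding a
      period first avoids a negative index.\<close>
    obtain k where k: "j + m = Suc k" using m by (cases "j + m") auto
    then have "int k = int j + int m - 1" by linarith
    from arg_cong[OF this, of "\<lambda>t. t * int d"] have "int (m + d) + int k * int d - int j * int d = int m * (1 + int d)"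
      by (simp add: algebra_simps)
    moreover have "elevation m d h (Suc k) \<le> elevation m d h k + int (m + d)"
      using pos[of "h (Suc k) - h k"] paths_step[OF h, of k] by (simp add: elevation_def algebra_simps)
    ultimately show "\<exists>k. int m dvd int (m + d) + int k * int d - int j * int d \<and>
      elevation m d h j \<le> elevation m d h k + int (m + d)"
      using elevation_period[OF h, of j] k by (metis dvd_triv_left)
  qed
  moreover have "sub_closed (m + 2 * d) (path_set m d h)"
  proof (rule sub_closed_path_set[OF assms(1) m h])
    fix j
    \<comment> \<open>Here the index goes back by two. Two periods leave room for this even when
      \<open>m = 1\<close>.\<close>
    have "\<exists>k. j + 2 * m = Suc (Suc k)" using m by (intro exI[of _ "j + 2 * m - 2"]) simp
    then obtain k where k: "j + 2 * m = Suc (Suc k)" by blast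
    then have "int k = int j + 2 * int m - 2" by linarith
    from arg_cong[OF this, of "\<lambda>t. t * int d"] have "int (m + 2 * d) + int k * int d - int j * int d = int m * (1 + 2 * int d)"
      by (simp add: algebra_simps)
    moreover have "elevation m d h (Suc (Suc k)) \<le> elevation m d h k + int (m + 2 * d)"
      using pos[of "h (Suc (Suc k)) - h k"] paths_two_steps[OF h, of k]
      by (simp add: elevation_def algebra_simps)
    moreover have "elevation m d h (j + 2 * m) = elevation m d h j"
      using elevation_period[OF h, of j] elevation_period[OF h, of "j + m"] by (simp add: mult_2 add.assoc)
    ultimately show "\<exists>k. int m dvd int (m + 2 * d) + int k * int d - int j * int d \<and>
      elevation m d h j \<le> elevation m d h k + int (m + 2 * d)"
      using k by (metis dvd_triv_left)
  qed
  ultimately show "path_set m d h \<in>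
      {X. finite X \<and> 0 \<notin> X \<and> (\<forall>a\<in>{m - d, m, m + d, m + 2 * d}. sub_closed a X)}"
    using finite_path_set[OF m h] by simp
next
  fix X assume "X \<in> {X. finite X \<and> 0 \<notin> X \<and> (\<forall>a\<in>{m - d, m, m + d, m + 2 * d}. sub_closed a X)}"
  then show "\<exists>h\<in>dominant_paths m d. X = path_set m d h"
    using path_set_surj[OF assms, of X] by auto
qed

section \<open>Counting the paths\<close>

text \<open>A path is encoded by the positions of its up steps and of its flat steps within a period.\<close>

definition step_words :: "nat \<Rightarrow> nat \<Rightarrow> (nat set \<times> nat set) set" where
  "step_words m s = {(A, B). A \<subseteq> {..<m} \<and> (\<forall>i\<in>A. Suc i mod m \<notin> A) \<and> B \<subseteq> {..<m} - A \<and>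
    2 * card A + card B = s}"

definition step :: "nat \<Rightarrow> nat set \<times> nat set \<Rightarrow> nat \<Rightarrow> int" where
  "step m = (\<lambda>(A, B) i. if i mod m \<in> A then 1 else if i mod m \<in> B then 0 else - 1)"

definition path_of_word :: "nat \<Rightarrow> nat set \<times> nat set \<Rightarrow> nat \<Rightarrow> int" where
  "path_of_word m w j = (\<Sum>i<j. step m w i)"

definition word_of_path :: "nat \<Rightarrow> (nat \<Rightarrow> int) \<Rightarrow> nat set \<times> nat set" where
  "word_of_path m h = ({i. i < m \<and> h (Suc i) - h i = 1}, {i. i < m \<and> h (Suc i) = h i})"

text \<open>A step equals twice the indicator of \<open>A\<close> plus the indicator of
  \<open>B\<close> minus 1. This is why \<open>step_words\<close> fixes
  \<open>2 * card A + card B\<close>: it prescribes the net descent over a period.\<close>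

lemma sum_step_period:
  assumes "A \<subseteq> {..<m}" "B \<subseteq> {..<m} - A"
  shows "(\<Sum>i<m. step m (A, B) i) = int (2 * card A + card B) - int m"
proof -
  have "(\<Sum>i<m. step m (A, B) i) = (\<Sum>i<m. 2 * of_bool (i \<in> A) + of_bool (i \<in> B) - 1)"
    using assms by (intro sum.cong) (auto simp: step_def)
  also have "\<dots> = 2 * int (card ({..<m} \<inter> A)) + int (card ({..<m} \<inter> B)) - int m"
    by (simp add: sum.distrib sum_subtractf sum_of_bool_eq flip: sum_distrib_left)
  also have "{..<m} \<inter> A = A" using assms by auto
  also have "{..<m} \<inter> B = B" using assms by auto
  finally show ?thesis by simp
qed

text \<open>A period shifts the path by a constant, so its differences are periodic and one period
  of them suffices. A step that is neither up nor flat must be \<open>- 1\<close>.\<close>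

lemma step_word_of_path:
  assumes "0 < m" "h \<in> paths m d"
  shows "step m (word_of_path m h) i = h (Suc i) - h i"
proof -
  have "h (Suc (j + q * m)) - h (j + q * m) = h (Suc j) - h j" for j q
  proof (induction q)
    case (Suc q)
    then show ?case
      using paths_period[OF assms(2), of "j + q * m"] paths_period[OF assms(2), of "Suc (j + q * m)"]
      by (simp add: algebra_simps)
  qed simp
  from this[of "i mod m" "i div m"]
  have "h (Suc i) - h i = h (Suc (i mod m)) - h (i mod m)" by simp
  then show ?thesis
    using paths_step[OF assms(2), of i] assms(1) by (auto simp: step_def word_of_path_def)
qed

lemma path_of_word_of_path:
  assumes "0 < m" "h \<in> paths m d"
  shows "path_of_word m (word_of_path m h) = h"
proof
  fix j show "path_of_word m (word_of_path m h) j = h j"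
    by (simp add: path_of_word_def step_word_of_path[OF assms] sum_lessThan_telescope paths_0[OF assms(2)])
qed

lemma word_of_path_in_step_words:
  assumes "0 < m" "d \<le> m" "h \<in> paths m d"
  shows "word_of_path m h \<in> step_words m (m - d)"
proof -
  let ?A = "fst (word_of_path m h)" and ?B = "snd (word_of_path m h)"
  have sub: "?A \<subseteq> {..<m}" "?B \<subseteq> {..<m} - ?A" by (auto simp: word_of_path_def)
  have "int (2 * card ?A + card ?B) - int m = path_of_word m (word_of_path m h) m"
    using sum_step_period[OF sub] by (simp add: path_of_word_def)
  also have "\<dots> = - int d"
    using path_of_word_of_path[OF assms(1,3)] paths_period[OF assms(3), of 0] paths_0[OF assms(3)] by simp
  finally have "2 * card ?A + card ?B = m - d" using assms(2) by linarith
  \<comment> \<open>Two cyclically adjacent up steps would climb by 2. Periodicity of the steps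
    covers the wrap-around from \<open>m - 1\<close> to 0.\<close>
  moreover have "Suc i mod m \<notin> ?A" if "i \<in> ?A" for i
  proof
    assume "Suc i mod m \<in> ?A"
    then have "step m (word_of_path m h) (Suc i) = 1" by (simp add: step_def split_beta)
    moreover have "h (Suc i) - h i = 1" using that by (simp add: word_of_path_def)
    ultimately show False
      using paths_two_steps[OF assms(3), of i] step_word_of_path[OF assms(1,3), of "Suc i"] by simp
  qed
  ultimately show ?thesis using sub by (auto simp: step_words_def split_beta)
qed

lemma path_of_word_in_paths:
  assumes "0 < m" "d \<le> m" "w \<in> step_words m (m - d)"
  shows "path_of_word m w \<in> paths m d"
proof -
  obtain A B where w: "w = (A, B)" "A \<subseteq> {..<m}" "\<And>i. i \<in> A \<Longrightarrow> Suc i mod m \<notin> A"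
    "B \<subseteq> {..<m} - A" "2 * card A + card B = m - d"
    using assms(3) by (auto simp: step_words_def)
  have "path_of_word m w (j + m) = path_of_word m w j - int d" for j
  proof (induction j)
    case 0
    then show ?case using sum_step_period[OF w(2,4)] w(1,5) assms(2) by (simp add: path_of_word_def)
  next
    case (Suc j)
    moreover have "step m w (j + m) = step m w j" by (simp add: step_def split_beta)
    ultimately show ?case by (simp add: path_of_word_def)
  qed
  moreover have "step m w i + step m w (Suc i) \<le> 1" for i
    using w(3)[of "i mod m"] by (auto simp: step_def w(1) mod_Suc_eq)
  moreover have "\<bar>step m w i\<bar> \<le> 1" for i by (simp add: step_def split_beta)
  ultimately show ?thesis by (auto simp: paths_def path_of_word_def add.assoc)
qed

lemma word_of_path_of_word:
  assumes "w \<in> step_words m s"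
  shows "word_of_path m (path_of_word m w) = w"
  using assms by (auto simp: word_of_path_def path_of_word_def step_def step_words_def split: if_splits)

lemma bij_betw_word_of_path:
  assumes "0 < m" "d \<le> m"
  shows "bij_betw (word_of_path m) (paths m d) (step_words m (m - d))"
  by (rule bij_betw_byWitness[where f' = "path_of_word m"])
    (auto simp: path_of_word_of_path[OF assms(1)] word_of_path_of_word
      word_of_path_in_step_words[OF assms] path_of_word_in_paths[OF assms])

section \<open>Sets without adjacent elements, on a line and on a cycle\<close>

definition sparse_sets :: "nat \<Rightarrow> nat \<Rightarrow> nat set set" where
  "sparse_sets n k = {A. A \<subseteq> {..<n} \<and> card A = k \<and> (\<forall>i\<in>A. Suc i \<notin> A)}"

lemma finite_sparse_sets [simp]: "finite (sparse_sets n k)"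
  by (rule finite_subset[of _ "Pow {..<n}"]) (auto simp: sparse_sets_def)

lemma sparse_sets_0 [simp]: "sparse_sets n 0 = {{}}"
  by (auto simp: sparse_sets_def card_eq_0_iff dest: finite_subset[OF _ finite_lessThan])

text \<open>The split is by membership of the largest position \<open>Suc n\<close>, whose presence
  excludes \<open>n\<close>.\<close>

lemma sparse_sets_Suc_Suc:
  "sparse_sets (Suc (Suc n)) (Suc k) =
    sparse_sets (Suc n) (Suc k) \<union> insert (Suc n) ` sparse_sets n k"
proof (intro equalityI subsetI)
  fix A assume A: "A \<in> sparse_sets (Suc (Suc n)) (Suc k)"
  then have fin: "finite A" and sub: "A \<subseteq> {..<Suc (Suc n)}" and sp: "\<forall>i\<in>A. Suc i \<notin> A" "card A = Suc k"
    by (auto simp: sparse_sets_def intro: finite_subset)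
  show "A \<in> sparse_sets (Suc n) (Suc k) \<union> insert (Suc n) ` sparse_sets n k"
  proof (cases "Suc n \<in> A")
    case True
    then have "A - {Suc n} \<in> sparse_sets n k"
      using sub sp fin by (force simp: sparse_sets_def less_Suc_eq)
    with True show ?thesis by (metis UnI2 image_eqI insert_Diff)
  next
    case False
    then show ?thesis using sub sp by (force simp: sparse_sets_def less_Suc_eq)
  qed
next
  fix A assume "A \<in> sparse_sets (Suc n) (Suc k) \<union> insert (Suc n) ` sparse_sets n k"
  then show "A \<in> sparse_sets (Suc (Suc n)) (Suc k)"
  proof
    assume "A \<in> insert (Suc n) ` sparse_sets n k"
    then obtain B where B: "A = insert (Suc n) B" "B \<subseteq> {..<n}" "card B = k" "\<forall>i\<in>B. Suc i \<notin> B"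
      by (auto simp: sparse_sets_def)
    have "finite B" using B(2) by (rule finite_subset) simp
    moreover have "n \<notin> B" "Suc n \<notin> B" "Suc (Suc n) \<notin> B" "B \<subseteq> {..<Suc (Suc n)}"
      using B(2) by auto
    moreover from this have "i \<noteq> n" if "i \<in> B" for i using that by blast
    ultimately show ?thesis using B by (simp add: sparse_sets_def)
  qed (force simp: sparse_sets_def)
qed

lemma card_sparse_sets: "card (sparse_sets n k) = (n + 1 - k) choose k"
proof (induction n arbitrary: k rule: induct_nat_012)
  case 0
  have "sparse_sets 0 k = (if k = 0 then {{}} else {})" by (auto simp: sparse_sets_def)
  then show ?case by simp
next
  case 1
  have "A \<in> sparse_sets (Suc 0) k \<longleftrightarrow> A = {} \<and> k = 0 \<or> A = {0} \<and> k = 1" for A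
    by (auto simp: sparse_sets_def lessThan_Suc subset_singleton_iff)
  then have "sparse_sets (Suc 0) k = (if k = 0 then {{}} else if k = 1 then {{0}} else {})" by auto
  then show ?case by (auto simp: binomial_eq_0)
next
  case (ge2 n)
  show ?case
  proof (cases k)
    case (Suc j)
    have "inj_on (insert (Suc n)) (sparse_sets n j)"
    proof (rule inj_onI)
      fix A B assume "A \<in> sparse_sets n j" "B \<in> sparse_sets n j" "insert (Suc n) A = insert (Suc n) B"
      moreover from this have "Suc n \<notin> A" "Suc n \<notin> B" by (auto simp: sparse_sets_def)
      ultimately show "A = B" by (metis insert_ident)
    qed
    moreover have "sparse_sets (Suc n) (Suc j) \<inter> insert (Suc n) ` sparse_sets n j = {}"
      by (auto simp: sparse_sets_def)
    ultimately have "card (sparse_sets (Suc (Suc n)) (Suc j)) =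
        ((n + 1 - j) choose Suc j) + ((n + 1 - j) choose j)"
      using ge2[of "Suc j"] ge2[of j] by (simp add: sparse_sets_Suc_Suc card_Un_disjoint card_image)
    \<comment> \<open>This is Pascal's rule for \<open>j \<le> n + 1\<close>. Beyond that the
      subtractions truncate to 0 and all three coefficients vanish.\<close>
    also have "\<dots> = (Suc (Suc n) + 1 - Suc j) choose Suc j"
      by (cases "j \<le> n + 1") (auto simp: Suc_diff_le binomial_eq_0)
    finally show ?thesis by (simp add: Suc)
  qed simp
qed

definition cyclic_sparse_sets :: "nat \<Rightarrow> nat \<Rightarrow> nat set set" where
  "cyclic_sparse_sets m k = {A. A \<subseteq> {..<m} \<and> card A = k \<and> (\<forall>i\<in>A. Suc i mod m \<notin> A)}"

lemma finite_cyclic_sparse_sets [simp]: "finite (cyclic_sparse_sets m k)"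
  by (rule finite_subset[of _ "Pow {..<m}"]) (auto simp: cyclic_sparse_sets_def)

lemma cyclic_sparse_sets_0 [simp]: "cyclic_sparse_sets m 0 = {{}}"
  by (auto simp: cyclic_sparse_sets_def card_eq_0_iff dest: finite_subset[OF _ finite_lessThan])

text \<open>A set containing \<open>m - 1\<close> avoids \<open>0\<close> and \<open>m - 2\<close>. For \<open>m = 2\<close> the truncated \<open>m - 3 = 0\<close> still
  gives the right family.\<close>

lemma cyclic_sparse_sets_Suc:
  assumes "2 \<le> m"
  shows "cyclic_sparse_sets m (Suc k) = sparse_sets (m - 1) (Suc k) \<union>
    (\<lambda>A. insert (m - 1) (Suc ` A)) ` sparse_sets (m - 3) k"
proof (intro equalityI subsetI)
  fix A assume "A \<in> cyclic_sparse_sets m (Suc k)"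
  then have A: "A \<subseteq> {..<m}" "card A = Suc k" "\<And>i. i \<in> A \<Longrightarrow> Suc i mod m \<notin> A"
    by (auto simp: cyclic_sparse_sets_def)
  have fin: "finite A" using A(1) by (rule finite_subset) simp
  show "A \<in> sparse_sets (m - 1) (Suc k) \<union> (\<lambda>A. insert (m - 1) (Suc ` A)) ` sparse_sets (m - 3) k"
  proof (cases "m - 1 \<in> A")
    case True
    define B where "B = {i. Suc i \<in> A \<and> Suc i \<noteq> m - 1}"
    have "0 \<notin> A" using A(3)[OF True] assms by simp
    have "A = insert (m - 1) (Suc ` B)"
    proof (intro equalityI subsetI)
      fix x assume "x \<in> A"
      then show "x \<in> insert (m - 1) (Suc ` B)"
        using \<open>0 \<notin> A\<close> by (cases x) (auto simp: B_def)
    qed (use True in \<open>auto simp: B_def\<close>)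
    moreover have "B \<in> sparse_sets (m - 3) k"
    proof -
      have "i < m - 3" if "i \<in> B" for i
      proof -
        have i: "Suc i \<in> A" "Suc i \<noteq> m - 1" using that by (auto simp: B_def)
        then have "Suc i < m - 1" using A(1) by fastforce
        moreover have "Suc (Suc i) \<noteq> m - 1"
          using A(3)[OF i(1)] True assms by auto
        ultimately show ?thesis by linarith
      qed
      moreover have "Suc i \<notin> B" if "i \<in> B" for i
      proof
        assume "Suc i \<in> B"
        then have "Suc (Suc i) \<in> A" by (simp add: B_def)
        moreover from this have "Suc (Suc i) < m" using A(1) by auto
        ultimately show False using A(3)[of "Suc i"] that by (simp add: B_def)
      qed
      moreover have "card B = k"
      proof -
        have "Suc ` B = A - {m - 1}" using \<open>A = insert (m - 1) (Suc ` B)\<close> by (auto simp: B_def)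
        then have "card (Suc ` B) = k" using True fin A(2) by simp
        then show ?thesis by (simp add: card_image)
      qed
      ultimately show ?thesis by (auto simp: sparse_sets_def)
    qed
    ultimately show ?thesis by blast
  next
    case False
    have lt: "i < m - 1" if "i \<in> A" for i
    proof -
      have "i < m" "i \<noteq> m - 1" using that A(1) False by auto
      then show ?thesis by linarith
    qed
    then have "Suc i \<notin> A" if "i \<in> A" for i using A(3)[OF that] lt[OF that] by simp
    with lt A(2) show ?thesis by (auto simp: sparse_sets_def)
  qed
next
  fix A assume "A \<in> sparse_sets (m - 1) (Suc k) \<union> (\<lambda>A. insert (m - 1) (Suc ` A)) ` sparse_sets (m - 3) k"
  then show "A \<in> cyclic_sparse_sets m (Suc k)"
  proof
    assume A: "A \<in> sparse_sets (m - 1) (Suc k)"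
    then have "i < m - 1" if "i \<in> A" for i using that by (auto simp: sparse_sets_def)
    with A show ?thesis by (force simp: cyclic_sparse_sets_def sparse_sets_def)
  next
    assume "A \<in> (\<lambda>A. insert (m - 1) (Suc ` A)) ` sparse_sets (m - 3) k"
    then obtain B where B: "A = insert (m - 1) (Suc ` B)" "\<And>i. i \<in> B \<Longrightarrow> i < m - 3"
      "card B = k" "\<And>i. i \<in> B \<Longrightarrow> Suc i \<notin> B" by (auto simp: sparse_sets_def)
    have "finite B" using B(2) by (intro finite_subset[of B "{..<m - 3}"]) auto
    moreover have "m - 1 \<notin> Suc ` B" using B(2) by fastforce
    ultimately have "card A = Suc k" by (simp add: B(1,3) card_image)
    moreover have "Suc i mod m \<notin> A" if "i \<in> A" for i
    proof (cases "i = m - 1")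
      case True
      then have "Suc i mod m = 0" using assms by simp
      then show ?thesis using assms by (auto simp: B(1))
    next
      case False
      then have "i \<in> Suc ` B" using that B(1) by blast
      then obtain j where j: "i = Suc j" "j \<in> B" by blast
      then have "Suc i mod m = Suc (Suc j)" "Suc (Suc j) \<noteq> m - 1" using B(2)[OF j(2)] by simp_all
      then show ?thesis using B(4)[OF j(2)] by (auto simp: B(1))
    qed
    moreover have "A \<subseteq> {..<m}"
      using B(2) assms by (fastforce simp: B(1))
    ultimately show ?thesis by (simp add: cyclic_sparse_sets_def)
  qed
qed

text \<open>The two summands count the sets without and with \<open>m - 1\<close>. The case
  \<open>k = 0\<close> is separate because truncated subtraction would make the second coefficient
  1.\<close>

lemma card_cyclic_sparse_sets:
  assumes "2 \<le> m" "k < m"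
  shows "card (cyclic_sparse_sets m k) =
    ((m - k) choose k) + (if k = 0 then 0 else (m - k - 1) choose (k - 1))"
proof (cases k)
  case (Suc j)
  have "inj_on (\<lambda>A. insert (m - 1) (Suc ` A)) (sparse_sets (m - 3) j)"
  proof (rule inj_onI)
    fix A B assume AB: "A \<in> sparse_sets (m - 3) j" "B \<in> sparse_sets (m - 3) j"
      "insert (m - 1) (Suc ` A) = insert (m - 1) (Suc ` B)"
    then have "m - 1 \<notin> Suc ` A" "m - 1 \<notin> Suc ` B" by (fastforce simp: sparse_sets_def)+
    with AB(3) have "Suc ` A = Suc ` B" by (metis insert_ident)
    then show "A = B" by (simp add: inj_image_eq_iff)
  qed
  moreover have "sparse_sets (m - 1) (Suc j) \<inter> (\<lambda>A. insert (m - 1) (Suc ` A)) ` sparse_sets (m - 3) j = {}"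
    by (auto simp: sparse_sets_def)
  ultimately have "card (cyclic_sparse_sets m k) =
      ((m - 1 + 1 - k) choose k) + ((m - 3 + 1 - j) choose j)"
    by (simp add: Suc cyclic_sparse_sets_Suc[OF assms(1)] card_Un_disjoint card_image card_sparse_sets)
  moreover have "(m - 3 + 1 - j) choose j = (m - k - 1) choose (k - 1)"
  \<comment> \<open>For \<open>m = 2\<close> the upper indices differ, 1 against 0, but
    \<open>k = 1\<close> makes both lower indices 0, so both coefficients are 1.\<close>
  proof (cases "m = 2")
    case False
    then have "m - 3 + 1 - j = m - k - 1" using assms Suc by simp
    then show ?thesis by (simp add: Suc)
  qed (use assms Suc in simp)
  ultimately show ?thesis using assms Suc by simp
qed simp

section \<open>Assembling the count\<close>

text \<open>Words are grouped by the number \<open>k\<close> of up steps, at most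
  \<open>s div 2\<close>. Each choice of \<open>A\<close> leaves \<open>m - k\<close> positions for
  the \<open>s - 2 * k\<close> flat steps.\<close>

lemma card_step_words:
  "finite (step_words m s) \<and> card (step_words m s) =
    (\<Sum>k\<le>s div 2. card (cyclic_sparse_sets m k) * ((m - k) choose (s - 2 * k)))"
proof -
  let ?F = "\<lambda>A. {B. B \<subseteq> {..<m} - A \<and> card B = s - 2 * card A}"
  let ?W = "\<lambda>k. Sigma (cyclic_sparse_sets m k) ?F"
  have eq: "step_words m s = (\<Union>k\<le>s div 2. ?W k)"
    by (auto simp: step_words_def cyclic_sparse_sets_def)
  have fin: "finite (?F A)" for A by (rule finite_subset[of _ "Pow {..<m}"]) auto
  then have finW: "finite (?W k)" for k by (intro finite_SigmaI finite_cyclic_sparse_sets)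
  have "card (?W k) = card (cyclic_sparse_sets m k) * ((m - k) choose (s - 2 * k))" for k
  proof -
    have "card (?F A) = (m - k) choose (s - 2 * k)" if "A \<in> cyclic_sparse_sets m k" for A
    proof -
      have "A \<subseteq> {..<m}" "card A = k" using that by (auto simp: cyclic_sparse_sets_def)
      moreover from this have "card ({..<m} - A) = m - k"
        by (simp add: card_Diff_subset finite_subset[of A "{..<m}"])
      ultimately show ?thesis using n_subsets[of "{..<m} - A"] by simp
    qed
    then show ?thesis using fin by (simp add: card_SigmaI)
  qed
  moreover have "card (\<Union>k\<le>s div 2. ?W k) = (\<Sum>k\<le>s div 2. card (?W k))"
    using finW by (intro card_UN_disjoint) (auto simp: cyclic_sparse_sets_def)
  ultimately show ?thesis using finW by (simp add: eq)
qed

lemma binom_of_nat: "binom (int n) (int k) = n choose k"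
  by (simp add: binom_def)

theorem theorem5p7:
  fixes s d :: nat
  assumes "0 < s" and "0 < d" and "coprime s d"
  shows "finite {p. is_simultaneous_core [s, s + d, s + 2 * d, s + 3 * d] p} \<and>
    real (card {p. is_simultaneous_core [s, s + d, s + 2 * d, s + 3 * d] p}) =
      1 / real (s + d) *
      (\<Sum>k = 0..nat \<lfloor>real s / 2\<rfloor>.
        (real (binom (int s + int d - int k - 1) (int k - 1)) +
         real (binom (int s + int d - int k) (int k))) *
        real (binom (int s + int d - int k) (int s - 2 * int k)))"
proof -
  define m where "m = s + d"
  let ?C = "{p. is_simultaneous_core [s, s + d, s + 2 * d, s + 3 * d] p}"
  let ?X = "{X. finite X \<and> 0 \<notin> X \<and> (\<forall>a\<in>{m - d, m, m + d, m + 2 * d}. sub_closed a X)}"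
  have "coprime m d" using assms(3) by (simp add: m_def coprime_iff_gcd_eq_1)
  then have m: "2 \<le> m" "0 < m" "d < m" "coprime d m" "m - d = s"
    using assms by (auto simp: m_def coprime_commute)
  have "s + 2 * d = m + d" "s + 3 * d = m + 2 * d" by (simp_all add: m_def)
  then have gens: "set [s, s + d, s + 2 * d, s + 3 * d] = {m - d, m, m + d, m + 2 * d}"
    by (simp only: list.set m(5) m_def[symmetric])
  have "0 \<notin> set [s, s + d, s + 2 * d, s + 3 * d]" using assms(1) by simp
  from bij_betw_cores_sub_closed[OF this] have "bij_betw beta_set ?C ?X" unfolding gens .
  \<comment> \<open>Cores and dominant paths correspond to the same closed sets, so inverting the
    second bijection links them.\<close>
  from bij_betw_trans[OF this bij_betw_inv_into[OF bij_betw_path_set[OF m(4,3)]]]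
  have C: "finite ?C \<longleftrightarrow> finite (dominant_paths m d)" "card ?C = card (dominant_paths m d)"
    by (auto dest: bij_betw_finite bij_betw_same_card)
  have "bij_betw (word_of_path m) (paths m d) (step_words m s)"
    using bij_betw_word_of_path[of m d] m by simp
  then have P: "finite (paths m d)" "card (paths m d) = card (step_words m s)"
    using card_step_words[of m s] by (auto dest: bij_betw_finite bij_betw_same_card)
  have fin: "finite (dominant_paths m d)"
    using P(1) by (rule finite_subset[rotated]) (auto simp: dominant_paths_def)
  \<comment> \<open>The cycle lemma supplies the factor \<open>m\<close>, and so the prefactor
    \<open>1 / (s + d)\<close>.\<close>
  have "m * card (dominant_paths m d) = card (step_words m s)"
    using bij_betw_same_card[OF bij_betw_rotate_path[OF m(4,2)]] P(2)
    by (simp add: card_cartesian_product mult.commute)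
  then have card: "real (card ?C) = 1 / real m * real (card (step_words m s))"
    unfolding C(2) using m(2) by (simp add: field_simps flip: of_nat_mult)
  have sum: "real (card (step_words m s)) =
    (\<Sum>k = 0..nat \<lfloor>real s / 2\<rfloor>.
        (real (binom (int s + int d - int k - 1) (int k - 1)) +
         real (binom (int s + int d - int k) (int k))) *
        real (binom (int s + int d - int k) (int s - 2 * int k)))"
  proof -
    have half: "nat \<lfloor>real s / 2\<rfloor> = s div 2"
      using floor_divide_of_nat_eq[of s 2, where 'a = real] by simp
    have summand: "card (cyclic_sparse_sets m k) * ((m - k) choose (s - 2 * k)) =
        (binom (int s + int d - int k - 1) (int k - 1) + binom (int s + int d - int k) (int k)) *
        binom (int s + int d - int k) (int s - 2 * int k)" if "k \<le> s div 2" for k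
    proof -
      have k: "k < m" "2 * k \<le> s" using that assms by (auto simp: m_def)
      have eqs: "int s + int d - int k = int (m - k)" "int s - 2 * int k = int (s - 2 * k)"
        using k by (auto simp: m_def)
      have "binom (int s + int d - int k) (int k) = (m - k) choose k"
        "binom (int s + int d - int k) (int s - 2 * int k) = (m - k) choose (s - 2 * k)"
        unfolding eqs by (rule binom_of_nat)+
      \<comment> \<open>At \<open>k = 0\<close> the lower index is \<open>- 1\<close>, where
        \<open>binom\<close> is 0; this matches the special case in the cyclic count.\<close>
      moreover have "binom (int s + int d - int k - 1) (int k - 1) =
          (if k = 0 then 0 else (m - k - 1) choose (k - 1))"
      proof (cases k)
        case (Suc j)
        have "int s + int d - int k - 1 = int (m - k - 1)" using k by (auto simp: m_def)
        moreover have "int k - 1 = int (k - 1)" using Suc by simp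
        ultimately show ?thesis using Suc by (simp only: binom_of_nat) simp
      qed (simp add: binom_def)
      ultimately show ?thesis using card_cyclic_sparse_sets[OF m(1) k(1)] by simp
    qed
    have "card (step_words m s) =
      (\<Sum>k = 0..s div 2. card (cyclic_sparse_sets m k) * ((m - k) choose (s - 2 * k)))"
      using card_step_words[of m s] by (simp add: atMost_atLeast0)
    also have "real \<dots> = (\<Sum>k = 0..s div 2.
        real (card (cyclic_sparse_sets m k) * ((m - k) choose (s - 2 * k))))"
      by (rule of_nat_sum)
    also have "\<dots> = (\<Sum>k = 0..s div 2.
        real ((binom (int s + int d - int k - 1) (int k - 1) + binom (int s + int d - int k) (int k)) *
          binom (int s + int d - int k) (int s - 2 * int k)))"
      by (rule sum.cong[OF refl]) (simp only: summand atLeastAtMost_iff)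
    finally show ?thesis by (simp only: half of_nat_add of_nat_mult)
  qed
  from C(1) fin have "finite ?C" by (rule iffD2)
  then show ?thesis using card[unfolded sum] unfolding m_def by (rule conjI)
qed

end
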